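(* Let $n$ be a positive integer and let $Y$ be a real Banach space. The pair $(\ell_\infty^n, Y)$ has the Bishop-Phelps-Bollobás property for operators if and only if $Y$ has the approximate hyperplane sum property for $\ell_\infty^n$ (AHSp-$\ell_\infty^n$). Moreover: (i) if $(\ell_\infty^n,Y)$ has the BPBp with the function $\eta_n$, then $Y$ has the AHSp-$\ell_\infty^n$ with the function $\gamma_n(\varepsilon)=\eta_n\bigl(\frac{\varepsilon}{n(n+1)}\bigr)$; (ii) if $Y$ has the AHSp-$\ell_\infty^n$ with the function $\gamma_n$, then the pair $(\ell_\infty^n,Y)$ has the BPBp with the function $\eta_n(\varepsilon)=\bigl(\gamma_n\bigl(\frac{\varepsilon}{n+1}\bigr)\bigr)^2$.
   Context: All spaces are real. $B_X$, $S_X$, $X^*$ denote the closed unit ball, unit sphere and topological dual of a normed space $X$; $L(X,Y)$ is the space of bounded linear operators with the operator norm. $\ell_\infty^n$ is $\mathbb{R}^n$ with the norm $\|x\|=\max_{i\le n}|x_i|$. BPBp: a pair $(X,Y)$ of Banach spaces has the Bishop-Phelps-Bollobás property for operators (BPBp) with a function $\eta:(0,1)\to(0,1)$ if for every $0<\varepsilon<1$ one has $0<\eta(\varepsilon)<\varepsilon$ and: whenever $T\in S_{L(X,Y)}$ and $x_0\in S_X$ satisfy $\|T(x_0)\|>1-\eta(\varepsilon)$, there exist $S\in S_{L(X,Y)}$ and $u_0\in S_X$ with $\|S(u_0)\|=1$, $\|u_0-x_0\|<\varepsilon$ and $\|S-T\|<\varepsilon$. The pair has the BPBp if it has it with some function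 $\eta$. $M_Y^n$ is the set of all $(y_i)_{i\le n}\in Y^n$ such that $\bigl\|\sum_{j=1}^k(-1)^{j+1}y_{i_j}\bigr\|\le 1$ for every odd $k\le n$ and all indices $1\le i_1<\dots<i_k\le n$. AHSp-$\ell_\infty^n$: $Y$ has the approximate hyperplane sum property for $\ell_\infty^n$ with a function $\gamma_n:(0,1)\to(0,1)$ if for every $0<\varepsilon<1$ one has $0<\gamma_n(\varepsilon)<\varepsilon$ and: for every $(y_i)_{i\le n}\in M_Y^n$, if there exist a nonempty $A\subset\{1,\dots,n\}$ and $y^*\in S_{Y^*}$ with $y^*(y_i)>1-\gamma_n(\varepsilon)$ for each $i\in A$, then there exists $(z_i)_{i\le n}\in M_Y^n$ with $\|z_i-y_i\|<\varepsilon$ for every $i\le n$ and $\bigl\|\sum_{i\in A}z_i\bigr\|=|A|$. $Y$ has the AHSp-$\ell_\infty^n$ if it has it with some function $\gamma_n$. *)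

theory Defs
  imports "HOL-Analysis.Analysis"
begin

(* The space l_infty^n is modelled with n = CARD('n): real vectors indexed by an arbitrary
   nonempty finite type 'n, under the maximum norm. A type of its own is needed because the
   norm on real ^ 'n is the Euclidean one. *)
typedef 'n linf = "UNIV :: ('n::finite \<Rightarrow> real) set"
  morphisms coord Linf
  by simp

setup_lifting type_definition_linf

lemma linf_eqI: "(\<And>i. coord x i = coord y i) \<Longrightarrow> x = y"
  by (simp add: coord_inject [symmetric] fun_eq_iff)

instantiation linf :: (finite) real_vector
begin

lift_definition zero_linf :: "'a linf" is "\<lambda>i. 0" .
lift_definition plus_linf :: "'a linf \<Rightarrow> 'a linf \<Rightarrow> 'a linf" is "\<lambda>x y i. x i + y i" .
lift_definition minus_linf :: "'a linf \<Rightarrow> 'a linf \<Rightarrow> 'a linf" is "\<lambda>x y i. x i - y i" .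
lift_definition uminus_linf :: "'a linf \<Rightarrow> 'a linf" is "\<lambda>x i. - x i" .
lift_definition scaleR_linf :: "real \<Rightarrow> 'a linf \<Rightarrow> 'a linf" is "\<lambda>r x i. r * x i" .

instance
  by standard (transfer; simp add: fun_eq_iff algebra_simps)+

end

lemmas coord_simps [simp] =
  zero_linf.rep_eq plus_linf.rep_eq minus_linf.rep_eq uminus_linf.rep_eq scaleR_linf.rep_eq

instantiation linf :: (finite) real_normed_vector
begin

definition norm_linf :: "'a linf \<Rightarrow> real" where
  "norm_linf x = (MAX i. \<bar>coord x i\<bar>)"

definition dist_linf :: "'a linf \<Rightarrow> 'a linf \<Rightarrow> real" where
  "dist_linf x y = norm (x - y)"

definition sgn_linf :: "'a linf \<Rightarrow> 'a linf" where
  "sgn_linf x = x /\<^sub>R norm x"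

definition uniformity_linf :: "('a linf \<times> 'a linf) filter" where
  "uniformity_linf = (INF e\<in>{0<..}. principal {(x, y). dist x y < e})"

definition open_linf :: "'a linf set \<Rightarrow> bool" where
  "open_linf U \<longleftrightarrow> (\<forall>x\<in>U. eventually (\<lambda>(x', y). x' = x \<longrightarrow> y \<in> U) uniformity)"

instance
proof
  have le: "norm x \<le> c \<longleftrightarrow> (\<forall>i. \<bar>coord x i\<bar> \<le> c)" for x :: "'a linf" and c
    unfolding norm_linf_def by (subst Max_le_iff) auto
  have coord_le: "\<bar>coord x i\<bar> \<le> norm x" for x :: "'a linf" and i
    using le by blast
  fix x y :: "'a linf" and r :: real
  have nonneg: "0 \<le> norm x" for x :: "'a linf"
    using coord_le [of x undefined] by linarith
  show "norm x = 0 \<longleftrightarrow> x = 0"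
  proof
    assume "norm x = 0"
    then show "x = 0"
      using coord_le [of x] by (intro linf_eqI) simp
  next
    assume "x = 0"
    then show "norm x = 0"
      using nonneg [of x] le [of x 0] by simp
  qed
  show "norm (x + y) \<le> norm x + norm y"
    unfolding le using coord_le [of x] coord_le [of y]
    by (auto intro: order_trans [OF abs_triangle_ineq] add_mono)
  have scale: "norm (s *\<^sub>R z) \<le> \<bar>s\<bar> * norm z" for s and z :: "'a linf"
    unfolding le by (auto simp: abs_mult intro: mult_left_mono coord_le)
  show "norm (r *\<^sub>R x) = \<bar>r\<bar> * norm x"
  proof (cases "r = 0")
    case True
    then show ?thesis using scale [of 0 x] nonneg [of "0 *\<^sub>R x"] by simp
  next
    case False
    then have "norm x \<le> \<bar>inverse r\<bar> * norm (r *\<^sub>R x)"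
      using scale [of "inverse r" "r *\<^sub>R x"] by simp
    then have "\<bar>r\<bar> * norm x \<le> norm (r *\<^sub>R x)"
      using False by (simp add: field_simps)
    then show ?thesis using scale [of r x] by linarith
  qed
qed (simp_all add: dist_linf_def sgn_linf_def uniformity_linf_def open_linf_def)

end

lemma norm_linf_le_iff: "norm x \<le> c \<longleftrightarrow> (\<forall>i. \<bar>coord x i\<bar> \<le> c)"
  unfolding norm_linf_def by (subst Max_le_iff) auto

lemma abs_coord_le_norm: "\<bar>coord x i\<bar> \<le> norm x"
  using norm_linf_le_iff by blast

instance linf :: (finite) banach
proof
  fix X :: "nat \<Rightarrow> 'a linf"
  assume X: "Cauchy X"
  have "Cauchy (\<lambda>n. coord (X n) i)" for i
  proof (rule metric_CauchyI)
    fix e :: real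
    assume "0 < e"
    then obtain N where N: "\<And>m n. m \<ge> N \<Longrightarrow> n \<ge> N \<Longrightarrow> dist (X m) (X n) < e"
      using metric_CauchyD [OF X] by blast
    show "\<exists>N. \<forall>m\<ge>N. \<forall>n\<ge>N. dist (coord (X m) i) (coord (X n) i) < e"
    proof (intro exI allI impI)
      fix m n assume "m \<ge> N" "n \<ge> N"
      then show "dist (coord (X m) i) (coord (X n) i) < e"
        using N [of m n] abs_coord_le_norm [of "X m - X n" i]
        by (simp add: dist_norm)
    qed
  qed
  then have "\<forall>i. \<exists>l. (\<lambda>n. coord (X n) i) \<longlonglongrightarrow> l"
    using Cauchy_convergent convergent_def by blast
  then obtain l where l: "\<And>i. (\<lambda>n. coord (X n) i) \<longlonglongrightarrow> l i"
    by metis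
  have "X \<longlonglongrightarrow> Linf l"
  proof (rule tendstoI)
    fix e :: real
    assume "0 < e"
    then have "\<forall>\<^sub>F n in sequentially. dist (coord (X n) i) (l i) < e / 2" for i
      using tendstoD [OF l, of "e / 2"] by simp
    then have "\<forall>\<^sub>F n in sequentially. \<forall>i. dist (coord (X n) i) (l i) < e / 2"
      by (rule eventually_all_finite)
    then show "\<forall>\<^sub>F n in sequentially. dist (X n) (Linf l) < e"
    proof eventually_elim
      case (elim n)
      then have "norm (X n - Linf l) \<le> e / 2"
        unfolding norm_linf_le_iff
        by (auto simp: Linf_inverse dist_real_def intro: less_imp_le)
      then show ?case
        using \<open>0 < e\<close> by (simp add: dist_norm)
    qed
  qed
  then show "convergent X"
    by (auto simp: convergent_def)
qed

(* The functions (0,1) -> (0,1) of the two properties below are total functions on the reals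
   of which only the values at arguments in (0,1) are ever used. *)

definition BPBp_with ::
    "'x::banach itself \<Rightarrow> 'y::banach itself \<Rightarrow> (real \<Rightarrow> real) \<Rightarrow> bool" where
  "BPBp_with X Y \<eta> \<longleftrightarrow>
     (\<forall>\<epsilon>. 0 < \<epsilon> \<and> \<epsilon> < 1 \<longrightarrow>
        0 < \<eta> \<epsilon> \<and> \<eta> \<epsilon> < \<epsilon> \<and>
        (\<forall>(T :: 'x \<Rightarrow>\<^sub>L 'y) x0.
           norm T = 1 \<and> norm x0 = 1 \<and> norm (blinfun_apply T x0) > 1 - \<eta> \<epsilon> \<longrightarrow>
           (\<exists>(S :: 'x \<Rightarrow>\<^sub>L 'y) u0.
              norm S = 1 \<and> norm u0 = 1 \<and> norm (blinfun_apply S u0) = 1 \<and>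
              norm (u0 - x0) < \<epsilon> \<and> norm (S - T) < \<epsilon>)))"

definition BPBp :: "'x::banach itself \<Rightarrow> 'y::banach itself \<Rightarrow> bool" where
  "BPBp X Y \<longleftrightarrow> (\<exists>\<eta>. BPBp_with X Y \<eta>)"

(* An n-tuple in Y is given by a function of which only the values on {1..n} matter. *)
definition M :: "nat \<Rightarrow> (nat \<Rightarrow> 'y::banach) set" where
  "M n = {y. \<forall>k i. odd k \<and> k \<le> n \<and> i ` {1..k} \<subseteq> {1..n} \<and> strict_mono_on {1..k} i \<longrightarrow>
               norm (\<Sum>j=1..k. (-1) ^ (j + 1) *\<^sub>R y (i j)) \<le> 1}"

definition AHSp_linf_with :: "nat \<Rightarrow> 'y::banach itself \<Rightarrow> (real \<Rightarrow> real) \<Rightarrow> bool" where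
  "AHSp_linf_with n Y \<gamma> \<longleftrightarrow>
     (\<forall>\<epsilon>. 0 < \<epsilon> \<and> \<epsilon> < 1 \<longrightarrow>
        0 < \<gamma> \<epsilon> \<and> \<gamma> \<epsilon> < \<epsilon> \<and>
        (\<forall>(y :: nat \<Rightarrow> 'y) \<in> M n. \<forall>A (f :: 'y \<Rightarrow>\<^sub>L real).
           A \<noteq> {} \<and> A \<subseteq> {1..n} \<and> norm f = 1 \<and>
           (\<forall>i\<in>A. blinfun_apply f (y i) > 1 - \<gamma> \<epsilon>) \<longrightarrow>
           (\<exists>z \<in> M n. (\<forall>i\<in>{1..n}. norm (z i - y i) < \<epsilon>) \<and>
                     norm (\<Sum>i\<in>A. z i) = real (card A))))"

definition AHSp_linf :: "nat \<Rightarrow> 'y::banach itself \<Rightarrow> bool" where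
  "AHSp_linf n Y \<longleftrightarrow> (\<exists>\<gamma>. AHSp_linf_with n Y \<gamma>)"

end

(* Sorting the coordinates of x (and possibly changing its sign) places a point of the unit sphere of
   l_infty^n in the simplex spanned by the vectors v_i = (-1, ..., -1, 1, ..., 1), the first 1 being in
   position i. The extreme points of the ball are, up to sign, the alternating sums with an odd number
   of terms of the v_i, so that norm T <= 1 if and only if (T v_i) lies in M_Y^n.

   AHSp => BPBp: if x_0 = sum alpha_i v_i is a convex combination at which T almost attains its norm,
   then T v_i is almost normed by one functional for all i in a set A carrying most of the mass alpha;
   perturbing (T v_i) to the tuple z provided by the AHSp yields S, which attains its norm at every
   convex combination of the v_i with i in A.

   BPBp => AHSp: apply the BPBp to the (normalised) operator with T v_i = y_i at the centroid of the
   v_i with i in A. A functional of norm one attaining its norm close to this centroid is 1 at each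
   v_i with i in A, because the segment from v_i to the new point can be prolonged inside the ball. *)
theory Submission imports Defs begin

section \<open>The Hahn-Banach theorem through minimal sublinear functionals\<close>

subsection \<open>Norming functionals\<close>

text \<open>Homogeneity is asked only as an inequality, which is easier to check for infima.
  Equality follows: for c > 0 apply it also to \<open>inverse c\<close>, and c = 0 is
  \<open>sublinear_zero\<close>.\<close>

definition sublinear :: "('a::real_vector \<Rightarrow> real) \<Rightarrow> bool" where
  "sublinear p \<longleftrightarrow>
     (\<forall>x y. p (x + y) \<le> p x + p y) \<and> (\<forall>c x. 0 \<le> c \<longrightarrow> p (c *\<^sub>R x) \<le> c * p x)"

lemma sublinearD:
  assumes "sublinear p"
  shows sublinear_add: "p (x + y) \<le> p x + p y"
    and sublinear_scaleR: "0 \<le> c \<Longrightarrow> p (c *\<^sub>R x) \<le> c * p x"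
  using assms unfolding sublinear_def by auto

lemma sublinear_norm: "sublinear norm"
  by (auto simp: sublinear_def norm_triangle_ineq)

lemma sublinear_zero:
  assumes "sublinear p"
  shows "p 0 = 0"
  using sublinear_scaleR [OF assms, of 0 0] sublinear_add [OF assms, of 0 0] by simp

lemma sublinear_ge_minus:
  assumes "sublinear p"
  shows "- p (- x) \<le> p x"
  using sublinear_add [OF assms, of x "- x"] sublinear_zero [OF assms] by simp

(* The witness is q y = inf_{t >= 0} (p (y + t x) - t p x). Applied to a minimal p, it shows that p is
   additive; applied to the norm, it forces every linear f below q to satisfy f x = norm x. *)
lemma sublinear_directional:
  assumes p: "sublinear p"
  obtains q where "sublinear q" "q \<le> p" "\<And>y. q y \<le> p (y + x) - p x" "q (- x) \<le> - p x"
proof -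
  define g where "g y t = p (y + t *\<^sub>R x) - t * p x" for y t
  define q where "q y = (INF t\<in>{0..}. g y t)" for y
  \<comment> \<open>The lower bound \<open>- p (- y)\<close> is uniform in t, because t p(x) \<le>
    p(t x) \<le> p(y + t x) + p(-y).\<close>
  have bdd: "bdd_below (g y ` {0..})" for y
  proof (rule bdd_belowI2)
    fix t :: real
    assume "t \<in> {0..}"
    have "t * p x \<le> p (t *\<^sub>R x)"
    proof (cases "t = 0")
      case True
      then show ?thesis by (simp add: sublinear_zero [OF p])
    next
      case False
      then have "p x \<le> inverse t * p (t *\<^sub>R x)"
        using sublinear_scaleR [OF p, of "inverse t" "t *\<^sub>R x"] \<open>t \<in> {0..}\<close> by simp
      then show ?thesis
        using False \<open>t \<in> {0..}\<close> by (simp add: field_simps)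
    qed
    moreover have "p (t *\<^sub>R x) \<le> p (y + t *\<^sub>R x) + p (- y)"
      using sublinear_add [OF p, of "y + t *\<^sub>R x" "- y"] by simp
    ultimately show "- p (- y) \<le> g y t"
      by (simp add: g_def)
  qed
  have q_le: "q y \<le> g y t" if "0 \<le> t" for y t
    unfolding q_def using bdd that by (intro cINF_lower) auto
  have q_ge: "m \<le> q y" if "\<And>t. 0 \<le> t \<Longrightarrow> m \<le> g y t" for m y
    unfolding q_def using that by (intro cINF_greatest) auto
  have qp: "q y \<le> p y" for y
    using q_le [of 0 y] by (simp add: g_def)
  have "sublinear q"
    unfolding sublinear_def
  proof (intro conjI allI impI)
    fix y z
    \<comment> \<open>The parameters s for y and t for z combine to s + t for y + z; the infimum is
      then taken first over t and next over s.\<close>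
    have "q (y + z) - g y s \<le> g z t" if "0 \<le> s" "0 \<le> t" for s t
      using q_le [of "s + t" "y + z"] that
        sublinear_add [OF p, of "y + s *\<^sub>R x" "z + t *\<^sub>R x"]
      by (simp add: g_def algebra_simps)
    then have "q (y + z) - g y s \<le> q z" if "0 \<le> s" for s
      using q_ge that by blast
    then have "q (y + z) - q z \<le> g y s" if "0 \<le> s" for s
      using that by (simp add: algebra_simps)
    then have "q (y + z) - q z \<le> q y"
      by (rule q_ge)
    then show "q (y + z) \<le> q y + q z" by simp
  next
    fix c :: real and y
    assume "0 \<le> c"
    show "q (c *\<^sub>R y) \<le> c * q y"
    proof (cases "c = 0")
      case True
      then show ?thesis using qp [of 0] sublinear_zero [OF p] by simp
    next
      case False
      then have "0 < c" using \<open>0 \<le> c\<close> by simp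
      have "q (c *\<^sub>R y) / c \<le> g y t" if "0 \<le> t" for t
      proof -
        \<comment> \<open>The substitution of c t for t makes g scale by c.\<close>
        have "q (c *\<^sub>R y) \<le> g (c *\<^sub>R y) (c * t)"
          using that \<open>0 < c\<close> by (intro q_le) simp
        also have "\<dots> \<le> c * g y t"
          using sublinear_scaleR [OF p \<open>0 \<le> c\<close>, of "y + t *\<^sub>R x"]
          by (simp add: g_def algebra_simps)
        finally show ?thesis using \<open>0 < c\<close> by (simp add: field_simps)
      qed
      then have "q (c *\<^sub>R y) / c \<le> q y"
        by (rule q_ge)
      then show ?thesis using \<open>0 < c\<close> by (simp add: field_simps)
    qed
  qed
  moreover have "q y \<le> p (y + x) - p x" for y
    using q_le [of 1 y] by (simp add: g_def)
  moreover have "q (- x) \<le> - p x"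
    using q_le [of 1 "- x"] sublinear_zero [OF p] by (simp add: g_def)
  ultimately show thesis
    using that qp by (auto simp: le_fun_def)
qed

text \<open>This is the chain condition for Zorn's lemma. The pointwise infimum is finite because
  -N(-y) \<le> -p(-y) \<le> p(y). It is subadditive because, of two members of a chain used at y and
  at z, the smaller one serves at both.\<close>

lemma sublinear_INF_chain:
  assumes C: "C \<noteq> {}" "\<And>p. p \<in> C \<Longrightarrow> sublinear p" "\<And>p. p \<in> C \<Longrightarrow> p \<le> N"
    and chain: "\<And>p q. p \<in> C \<Longrightarrow> q \<in> C \<Longrightarrow> p \<le> q \<or> q \<le> p"
  obtains q where "sublinear q" "\<And>p. p \<in> C \<Longrightarrow> q \<le> p"
proof -
  define q where "q y = (INF p\<in>C. p y)" for y
  have bdd: "bdd_below ((\<lambda>p. p y) ` C)" for y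
  proof (rule bdd_belowI2)
    fix p
    assume p: "p \<in> C"
    then show "- N (- y) \<le> p y"
      using sublinear_ge_minus [OF C(2) [OF p], of y] C(3) [OF p]
      by (auto simp: le_fun_def intro: order_trans [rotated])
  qed
  have q_le: "q y \<le> p y" if "p \<in> C" for p y
    unfolding q_def using bdd that by (intro cINF_lower) auto
  have q_ge: "m \<le> q y" if "\<And>p. p \<in> C \<Longrightarrow> m \<le> p y" for m y
    unfolding q_def using that C(1) by (intro cINF_greatest) auto
  have "sublinear q"
    unfolding sublinear_def
  proof (intro conjI allI impI)
    fix y z
    have "q (y + z) - p y \<le> r z" if pr: "p \<in> C" "r \<in> C" for p r
    proof -
      obtain s where "s \<in> C" "s \<le> p" "s \<le> r"
        using chain [OF pr] pr by auto
      then have "q (y + z) \<le> s y + s z" "s y \<le> p y" "s z \<le> r z"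
        using q_le [OF \<open>s \<in> C\<close>, of "y + z"] sublinear_add [OF C(2) [OF \<open>s \<in> C\<close>], of y z]
        by (auto simp: le_fun_def)
      then show ?thesis by simp
    qed
    then have "q (y + z) - p y \<le> q z" if "p \<in> C" for p
      using q_ge that by blast
    then have "q (y + z) - q z \<le> p y" if "p \<in> C" for p
      using that by (simp add: algebra_simps)
    then have "q (y + z) - q z \<le> q y"
      by (rule q_ge)
    then show "q (y + z) \<le> q y + q z" by simp
  next
    fix c :: real and y
    assume "0 \<le> c"
    show "q (c *\<^sub>R y) \<le> c * q y"
    proof (cases "c = 0")
      case True
      obtain p where "p \<in> C" using C(1) by auto
      then show ?thesis
        using q_le [of p 0] True sublinear_zero [OF C(2) [of p]] by simp
    next
      case False
      then have "0 < c" using \<open>0 \<le> c\<close> by simp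
      have "q (c *\<^sub>R y) / c \<le> p y" if "p \<in> C" for p
        using order_trans [OF q_le [OF that] sublinear_scaleR [OF C(2) [OF that] \<open>0 \<le> c\<close>]] \<open>0 < c\<close>
        by (simp add: field_simps)
      then have "q (c *\<^sub>R y) / c \<le> q y"
        by (rule q_ge)
      then show ?thesis using \<open>0 < c\<close> by (simp add: field_simps)
    qed
  qed
  then show thesis
    using that q_le by (auto simp: le_fun_def)
qed

text \<open>The directional functional below p must equal p by minimality, and its estimate then
  reads as superadditivity of p.\<close>

lemma linear_if_minimal_sublinear:
  assumes p: "sublinear p"
    and minimal: "\<And>q. sublinear q \<Longrightarrow> q \<le> p \<Longrightarrow> q = p"
  shows "linear p"
proof -
  have add: "p (x + y) = p x + p y" for x y
  proof (rule antisym)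
    obtain q where "sublinear q" "q \<le> p" "\<And>z. q z \<le> p (z + y) - p y"
      using sublinear_directional [OF p] by metis
    then show "p x + p y \<le> p (x + y)"
      using minimal [of q] by (metis le_diff_eq)
  qed (rule sublinear_add [OF p])
  have neg: "p (- x) = - p x" for x
    using add [of x "- x"] sublinear_zero [OF p] by simp
  \<comment> \<open>Since p is odd, the one-sided inequality at -x is the reverse inequality at
    x.\<close>
  have pos: "p (c *\<^sub>R x) = c * p x" if "0 \<le> c" for c x
    using sublinear_scaleR [OF p that, of x] sublinear_scaleR [OF p that, of "- x"]
    by (simp add: neg)
  have "p (c *\<^sub>R x) = c * p x" for c x
    using pos [of c x] pos [of "- c" x] neg [of "c *\<^sub>R x"] by (cases "0 \<le> c") simp_all
  then show ?thesis
    by (intro linearI) (simp_all add: add)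
qed

lemma sublinear_dominates_linear:
  assumes p: "sublinear p"
  obtains f where "linear f" "f \<le> p"
proof -
  define D where "D = {q. sublinear q \<and> q \<le> p}"
  have "\<exists>m\<in>D. \<forall>a\<in>D. a \<le> m \<longrightarrow> a = m"
  proof (rule predicate_Zorn)
    \<comment> \<open>The order is reversed, since Zorn's lemma yields maximal elements and a
      minimal functional is wanted.\<close>
    show "partial_order_on D (relation_of (\<lambda>q r. r \<le> q) D)"
      by (rule partial_order_on_relation_ofI) auto
  next
    fix C
    assume C: "C \<in> Chains (relation_of (\<lambda>q r. r \<le> q) D)"
    show "\<exists>u\<in>D. \<forall>a\<in>C. u \<le> a"
    proof (cases "C = {}")
      case True
      then show ?thesis using p by (auto simp: D_def)
    next
      case False
      have CD: "C \<subseteq> D" and chain: "\<And>q r. q \<in> C \<Longrightarrow> r \<in> C \<Longrightarrow> q \<le> r \<or> r \<le> q"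
        using C by (auto simp: Chains_def relation_of_def)
      obtain u where u: "sublinear u" "\<And>q. q \<in> C \<Longrightarrow> u \<le> q"
        using sublinear_INF_chain [OF False _ _ chain, of p] CD unfolding D_def by blast
      moreover obtain q where "q \<in> C" using False by auto
      ultimately show ?thesis
        using CD unfolding D_def by (blast intro: order_trans)
    qed
  qed
  then obtain m where "sublinear m" "m \<le> p" "\<And>q. sublinear q \<Longrightarrow> q \<le> p \<Longrightarrow> q \<le> m \<Longrightarrow> q = m"
    unfolding D_def by blast
  then show thesis
    using that linear_if_minimal_sublinear [of m] by (meson order_trans)
qed

text \<open>The direction x is built into the bound q, so any linear f below q will do: -f(x) =
  f(-x) \<le> -norm x, while f \<le> norm gives the reverse inequality.\<close>

lemma norming_functional:
  fixes x :: "'a::real_normed_vector"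
  assumes "x \<noteq> 0"
  obtains f :: "'a \<Rightarrow>\<^sub>L real" where "norm f = 1" "f x = norm x"
proof -
  obtain q where q: "sublinear q" "q \<le> norm" "q (- x) \<le> - norm x"
    using sublinear_directional [OF sublinear_norm] by metis
  obtain f where f: "linear f" "f \<le> q"
    using sublinear_dominates_linear [OF q(1)] by blast
  have le: "f y \<le> norm y" for y
    using f(2) q(2) by (meson le_fun_def order_trans)
  have abs_le: "\<bar>f y\<bar> \<le> norm y" for y
    using le [of y] le [of "- y"] by (simp add: linear_neg [OF f(1)] abs_le_iff)
  have "bounded_linear f"
    using f(1) abs_le by (intro bounded_linear.intro bounded_linear_axioms.intro exI [of _ 1]) auto
  then obtain F :: "'a \<Rightarrow>\<^sub>L real" where F: "blinfun_apply F = f"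
    using bounded_linear_Blinfun_apply by blast
  have "f (- x) \<le> - norm x"
    using f(2) q(3) by (meson le_fun_def order_trans)
  then have fx: "f x = norm x"
    using le [of x] by (simp add: linear_neg [OF f(1)])
  have "norm F = 1"
    using assms abs_le fx by (intro norm_blinfun_eqI [of _ _ x]) (auto simp: F)
  then show thesis
    using that fx F by metis
qed

section \<open>The basis of sorted sign vectors and its coordinate functionals\<close>

subsection \<open>The simplices of sorted vectors\<close>

lemma coord_sum: "finite I \<Longrightarrow> coord (\<Sum>i\<in>I. f i) j = (\<Sum>i\<in>I. coord (f i) j)"
  by (induction I rule: finite_induct) simp_all

text \<open>The ordering of the coordinates is a parameter because it has to be adapted to a given
  point. The simplices spanned by the \<open>v i\<close> for the various orderings are those of the
  Kuhn triangulation of the facets of the cube on which some coordinate is 1.\<close>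

locale kuhn_basis =
  fixes n :: nat and \<sigma> :: "nat \<Rightarrow> 'n::finite" and \<rho> :: "'n \<Rightarrow> nat"
  assumes rho_mem: "\<rho> j \<in> {1..n}"
    and sigma_rho: "\<sigma> (\<rho> j) = j"
    and rho_sigma: "i \<in> {1..n} \<Longrightarrow> \<rho> (\<sigma> i) = i"
begin

definition v :: "nat \<Rightarrow> 'n linf" where
  "v i = Linf (\<lambda>j. if i \<le> \<rho> j then 1 else - 1)"

(* The cyclic convention X 0 = - X n makes c i the coordinate functionals of the basis v uniformly in i. *)
definition X :: "'n linf \<Rightarrow> nat \<Rightarrow> real" where
  "X x m = (if m = 0 then - coord x (\<sigma> n) else coord x (\<sigma> m))"

definition c :: "nat \<Rightarrow> 'n linf \<Rightarrow> real" where
  "c i x = (X x i - X x (i - 1)) / 2"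

lemma n_pos: "0 < n"
  using rho_mem by (metis atLeastAtMost_iff le_zero_eq not_gr_zero not_one_le_zero)

lemma coord_v: "coord (v i) j = (if i \<le> \<rho> j then 1 else - 1)"
  by (simp add: v_def Linf_inverse)

lemma abs_coord_v: "\<bar>coord (v i) j\<bar> = 1"
  by (simp add: coord_v)

lemma norm_v: "norm (v i) = 1"
  using abs_coord_le_norm [of "v i" undefined] norm_linf_le_iff [of "v i" 1]
  by (simp add: abs_coord_v antisym)

lemma X_zero: "X x 0 = - X x n"
  using n_pos by (simp add: X_def)

lemma X_rho: "X x (\<rho> j) = coord x j"
  using rho_mem [of j] by (simp add: X_def sigma_rho)

lemma X_linear: "X (x + y) m = X x m + X y m" "X (r *\<^sub>R x) m = r * X x m"
  by (simp_all add: X_def)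

lemma abs_X_le: "\<bar>X x m\<bar> \<le> norm x"
  by (simp add: X_def abs_coord_le_norm)

lemma c_linear: "c i (x + y) = c i x + c i y" "c i (r *\<^sub>R x) = r * c i x"
  by (simp_all add: c_def X_linear field_simps)

lemma abs_c_le: "\<bar>c i x\<bar> \<le> norm x"
  using abs_X_le [of x i] abs_X_le [of x "i - 1"] unfolding c_def by (simp add: field_simps)

lemma X_v:
  assumes "k \<in> {1..n}" "m \<le> n"
  shows "X (v k) m = (if k \<le> m then 1 else - 1)"
proof (cases "m = 0")
  case False
  then show ?thesis using assms by (simp add: X_def coord_v rho_sigma)
next
  case True
  then show ?thesis
    using assms n_pos by (simp add: X_def coord_v rho_sigma)
qed

lemma c_v:
  assumes "k \<in> {1..n}" "i \<in> {1..n}"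
  shows "c i (v k) = (if i = k then 1 else 0)"
  using assms X_v [of k i] X_v [of k "i - 1"] by (auto simp: c_def)

lemma sum_c:
  assumes "a \<le> b"
  shows "(\<Sum>i\<in>{a<..b}. c i x) = (X x b - X x a) / 2"
  using assms
proof (induction b rule: dec_induct)
  case (step b)
  then have "{a<..Suc b} = insert (Suc b) {a<..b}" by auto
  then show ?case using step by (simp add: c_def field_simps)
qed simp

text \<open>The sum telescopes to half of X n - X 0, and X 0 = -X n. Hence a point with last
  coordinate 1 is an affine combination of the \<open>v i\<close>.\<close>

lemma sum_c_all: "(\<Sum>i=1..n. c i x) = X x n"
proof -
  have "{1..n} = {0<..n}" by auto
  then show ?thesis using sum_c [of 0 n x] by (simp add: X_zero)
qed

text \<open>In coordinate j the sign of \<open>v i\<close> changes once, after i = \<rho> j. Both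
  blocks telescope, and the boundary terms cancel because X 0 = -X n.\<close>

lemma expansion: "(\<Sum>i=1..n. c i x *\<^sub>R v i) = x"
proof (rule linf_eqI)
  fix j
  let ?m = "\<rho> j"
  have m: "?m \<le> n" "{1..n} = {0<..?m} \<union> {?m<..n}" "{0<..?m} \<inter> {?m<..n} = {}"
    using rho_mem [of j] by auto
  have "coord (\<Sum>i=1..n. c i x *\<^sub>R v i) j = (\<Sum>i=1..n. c i x * coord (v i) j)"
    by (simp add: coord_sum)
  also have "\<dots> = (\<Sum>i\<in>{0<..?m}. c i x * coord (v i) j) + (\<Sum>i\<in>{?m<..n}. c i x * coord (v i) j)"
    unfolding m(2) by (rule sum.union_disjoint) (use m in auto)
  also have "\<dots> = (\<Sum>i\<in>{0<..?m}. c i x) + (\<Sum>i\<in>{?m<..n}. - c i x)"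
    by (intro arg_cong2 [where f = "(+)"] sum.cong) (auto simp: coord_v)
  also have "\<dots> = X x ?m"
    using sum_c [of 0 ?m x] sum_c [OF m(1), of x] by (simp add: sum_negf X_zero field_simps)
  finally show "coord (\<Sum>i=1..n. c i x *\<^sub>R v i) j = coord x j"
    by (simp add: X_rho)
qed

lemma blinfun_expansion:
  "blinfun_apply T x = (\<Sum>i=1..n. c i x *\<^sub>R blinfun_apply T (v i))"
proof -
  have "blinfun_apply T x = blinfun_apply T (\<Sum>i=1..n. c i x *\<^sub>R v i)"
    by (simp only: expansion)
  then show ?thesis
    by (simp add: blinfun.bilinear_simps)
qed

text \<open>Perturbing each value at \<open>v i\<close> by less than \<delta> moves the operator by
  less than n \<delta>; this is where the factor n in the estimates comes from.\<close>

lemma norm_blinfun_le_sum: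
  fixes T :: "'n linf \<Rightarrow>\<^sub>L 'y::real_normed_vector"
  shows "norm T \<le> (\<Sum>i=1..n. norm (T (v i)))"
proof (rule norm_blinfun_bound)
  fix x
  have "norm (T x) \<le> (\<Sum>i=1..n. norm (c i x *\<^sub>R T (v i)))"
    unfolding blinfun_expansion [of T x] by (rule norm_sum)
  also have "\<dots> \<le> (\<Sum>i=1..n. norm x * norm (T (v i)))"
    by (intro sum_mono) (simp add: abs_c_le mult_right_mono)
  finally show "norm (T x) \<le> (\<Sum>i=1..n. norm (T (v i))) * norm x"
    by (simp add: sum_distrib_left mult.commute)
qed (simp add: sum_nonneg)

lemma obtain_blinfun:
  fixes y :: "nat \<Rightarrow> 'y::real_normed_vector"
  obtains T :: "'n linf \<Rightarrow>\<^sub>L 'y" where "\<And>i. i \<in> {1..n} \<Longrightarrow> blinfun_apply T (v i) = y i"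
proof -
  define g where "g x = (\<Sum>i=1..n. c i x *\<^sub>R y i)" for x
  have "bounded_linear g"
  proof (rule bounded_linear_intro)
    show "g (x + z) = g x + g z" "g (r *\<^sub>R x) = r *\<^sub>R g x" for x z r
      by (simp_all add: g_def c_linear scaleR_add_left sum.distrib scaleR_sum_right)
    show "norm (g x) \<le> norm x * (\<Sum>i=1..n. norm (y i))" for x
    proof -
      have "norm (g x) \<le> (\<Sum>i=1..n. norm (c i x *\<^sub>R y i))"
        unfolding g_def by (rule norm_sum)
      also have "\<dots> \<le> (\<Sum>i=1..n. norm x * norm (y i))"
        by (intro sum_mono) (simp add: abs_c_le mult_right_mono)
      finally show ?thesis by (simp add: sum_distrib_left)
    qed
  qed
  then have *: "blinfun_apply (Blinfun g) = g"
    by (rule bounded_linear_Blinfun_apply)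
  show thesis
  proof (rule that [of "Blinfun g"])
    fix k assume k: "k \<in> {1..n}"
    have "g (v k) = (\<Sum>i=1..n. if i = k then y i else 0)"
      unfolding g_def by (intro sum.cong) (use k in \<open>auto simp: c_v\<close>)
    then show "blinfun_apply (Blinfun g) (v k) = y k"
      using k by (simp add: *)
  qed
qed

section \<open>The unit ball of operators and the set \<open>M n\<close>\<close>

lemma norm_alternating_sum_v:
  assumes "odd k" "strict_mono_on {1..k} i"
  shows "norm (\<Sum>j=1..k. (-1) ^ (j + 1) *\<^sub>R v (i j)) \<le> 1"
  unfolding norm_linf_le_iff
proof
  fix l
  let ?s = "\<lambda>k. coord (\<Sum>j=1..k. (-1) ^ (j + 1) *\<^sub>R v (i j)) l"
  \<comment> \<open>Invariant for all partial sums, of either parity: while the indices stay at most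
    \<rho> l, the terms 1, -1, ... give 1 or 0. Beyond it the signs are swapped, so the sum
    oscillates between 0 and -1 or between 2 and 1, according to the parity at the crossing.\<close>
  have "strict_mono_on {1..k} i \<Longrightarrow>
      (k = 0 \<or> i k \<le> \<rho> l) \<and> ?s k = (if odd k then 1 else 0) \<or>
      0 < k \<and> \<rho> l < i k \<and> (if odd k then ?s k \<in> {-1, 1} else ?s k \<in> {0, 2})" for k
  proof (induction k)
    case (Suc k)
    have "strict_mono_on {1..k} i"
      using Suc.prems by (rule monotone_on_subset) auto
    moreover have "0 < k \<Longrightarrow> i k < i (Suc k)"
      using Suc.prems by (auto simp: strict_mono_on_def)
    ultimately show ?case
      using Suc.IH by (auto simp: coord_v)
  qed simp
  from this [OF assms(2)] assms(1)
  show "\<bar>?s k\<bar> \<le> 1" by auto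
qed

lemma blinfun_in_M:
  fixes T :: "'n linf \<Rightarrow>\<^sub>L 'y::banach"
  assumes "norm T \<le> 1"
  shows "(\<lambda>i. T (v i)) \<in> M n"
  unfolding M_def
proof (intro CollectI allI impI)
  fix k i
  assume ki: "odd k \<and> k \<le> n \<and> i ` {1..k} \<subseteq> {1..n} \<and> strict_mono_on {1..k} i"
  let ?x = "\<Sum>j=1..k. (-1) ^ (j + 1) *\<^sub>R v (i j)"
  have "norm (T ?x) \<le> norm T * norm ?x"
    by (rule norm_blinfun)
  also have "\<dots> \<le> 1 * 1"
    using assms ki by (intro mult_mono norm_alternating_sum_v) auto
  finally show "norm (\<Sum>j=1..k. (-1) ^ (j + 1) *\<^sub>R T (v (i j))) \<le> 1"
    by (simp add: blinfun.bilinear_simps)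
qed

(* c i x is nonzero exactly at the sign changes of X x, where it alternates between 1 and -1; as X x
   runs from -1 to 1, the number of changes is odd. *)
lemma sign_sum_eq_alternating_sum:
  fixes y :: "nat \<Rightarrow> 'y::real_vector"
  assumes "\<And>m. m \<le> n \<Longrightarrow> X x m \<in> {-1, 1}" "X x n = 1"
  obtains k i where "odd k" "k \<le> n" "i ` {1..k} \<subseteq> {1..n}" "strict_mono_on {1..k} i"
    "(\<Sum>j=1..n. c j x *\<^sub>R y j) = (\<Sum>j=1..k. (-1) ^ (j + 1) *\<^sub>R y (i j))"
proof -
  \<comment> \<open>For each prefix, the parity of the number k of sign changes records the current
    sign. A new change therefore has the coefficient that belongs to position k + 1.\<close>
  have "m \<le> n \<Longrightarrow> \<exists>k i. i ` {1..k} \<subseteq> {1..m} \<and> strict_mono_on {1..k} i \<and>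
      X x m = (if odd k then 1 else - 1) \<and>
      (\<Sum>j=1..m. c j x *\<^sub>R y j) = (\<Sum>j=1..k. (-1) ^ (j + 1) *\<^sub>R y (i j))" for m
  proof (induction m)
    case 0
    show ?case
      by (rule exI [of _ 0]) (use assms(2) in \<open>simp add: X_zero\<close>)
  next
    case (Suc m)
    then obtain k i where ki: "i ` {1..k} \<subseteq> {1..m}" "strict_mono_on {1..k} i"
        "X x m = (if odd k then 1 else - 1)"
        "(\<Sum>j=1..m. c j x *\<^sub>R y j) = (\<Sum>j=1..k. (-1) ^ (j + 1) *\<^sub>R y (i j))"
      by auto
    show ?case
    proof (cases "X x (Suc m) = X x m")
      case True
      have "i ` {1..k} \<subseteq> {1..Suc m}" using ki(1) by fastforce
      moreover have "c (Suc m) x = 0" using True by (simp add: c_def)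
      ultimately show ?thesis
        using ki True by (intro exI [of _ k] exI [of _ i]) simp
    next
      case False
      let ?i = "i(Suc k := Suc m)"
      have X: "X x (Suc m) = (if odd k then - 1 else 1)"
        using assms(1) [OF Suc.prems] False ki(3) by auto
      have "c (Suc m) x = (-1) ^ (Suc k + 1)"
        using X ki(3) by (simp add: c_def)
      moreover have "?i ` {1..Suc k} \<subseteq> {1..Suc m}"
        using ki(1) by (fastforce simp: le_Suc_eq)
      moreover have "strict_mono_on {1..Suc k} ?i"
      proof (rule strict_mono_onI)
        fix r s
        assume rs: "r \<in> {1..Suc k}" "s \<in> {1..Suc k}" "r < s"
        show "?i r < ?i s"
        proof (cases "s = Suc k")
          case True
          then have "i r \<in> {1..m}" using rs ki(1) by fastforce
          then show ?thesis using True rs by simp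
        next
          case False
          then show ?thesis
            using rs strict_mono_onD [OF ki(2), of r s] by simp
        qed
      qed
      moreover have "(\<Sum>j=1..Suc m. c j x *\<^sub>R y j) =
          (\<Sum>j=1..Suc k. (-1) ^ (j + 1) *\<^sub>R y (?i j))"
        using calculation(1) ki(4) by simp
      moreover have "X x (Suc m) = (if odd (Suc k) then 1 else - 1)"
        using X by simp
      ultimately show ?thesis by blast
    qed
  qed
  from this [OF order_refl] obtain k i where ki: "i ` {1..k} \<subseteq> {1..n}" "strict_mono_on {1..k} i"
      "odd k" "(\<Sum>j=1..n. c j x *\<^sub>R y j) = (\<Sum>j=1..k. (-1) ^ (j + 1) *\<^sub>R y (i j))"
    using assms(2) by (auto split: if_splits)
  have "k \<le> n"
    using card_inj_on_le [OF strict_mono_on_imp_inj_on [OF ki(2)] ki(1)] by simp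
  then show thesis using that ki by blast
qed

text \<open>The norm of T x is convex in x, so it suffices to bound it at the vertices of the cube.
  A vertex with last coordinate 1 is an alternating sum of the \<open>v i\<close>, and negation
  gives the other vertices.\<close>

lemma norm_le_one_if_in_M:
  fixes T :: "'n linf \<Rightarrow>\<^sub>L 'y::banach"
  assumes "y \<in> M n" and T: "\<And>i. i \<in> {1..n} \<Longrightarrow> T (v i) = y i"
  shows "norm T \<le> 1"
proof -
  have sign_top: "norm (T x) \<le> 1" if "\<And>j. coord x j \<in> {-1, 1}" "X x n = 1" for x
  proof -
    have "X x m \<in> {-1, 1}" for m
      using that(1) [of "\<sigma> n"] that(1) [of "\<sigma> m"] by (auto simp: X_def)
    then obtain k i where ki: "odd k" "k \<le> n" "i ` {1..k} \<subseteq> {1..n}" "strict_mono_on {1..k} i"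
      "(\<Sum>j=1..n. c j x *\<^sub>R y j) = (\<Sum>j=1..k. (-1) ^ (j + 1) *\<^sub>R y (i j))"
      by (rule sign_sum_eq_alternating_sum [OF _ \<open>X x n = 1\<close>])
    have "T x = (\<Sum>j=1..n. c j x *\<^sub>R y j)"
      by (subst blinfun_expansion) (simp add: T)
    then show ?thesis
      using ki \<open>y \<in> M n\<close> by (auto simp: M_def)
  qed
  have sign: "norm (T x) \<le> 1" if "\<And>j. coord x j \<in> {-1, 1}" for x
  proof (cases "X x n = 1")
    case True
    then show ?thesis using that sign_top by blast
  next
    case False
    then have "X (- x) n = 1"
      using that [of "\<sigma> n"] n_pos by (auto simp: X_def)
    moreover have "coord (- x) j \<in> {-1, 1}" for j
      using that [of j] by auto
    ultimately have "norm (T (- x)) \<le> 1"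
      using sign_top by blast
    then show ?thesis by (simp add: blinfun.bilinear_simps)
  qed
  \<comment> \<open>J contains the coordinates not yet known to be 1 or -1. Each of them is removed
    by writing x as a convex combination, with weights t and 1 - t, of the points where that
    coordinate is 1 and -1.\<close>
  have cube: "norm (T x) \<le> 1"
    if "finite J" "\<And>j. \<bar>coord x j\<bar> \<le> 1" "\<And>j. j \<notin> J \<Longrightarrow> coord x j \<in> {-1, 1}" for J x
    using that
  proof (induction J arbitrary: x rule: finite_induct)
    case empty
    then show ?case using sign by blast
  next
    case (insert l J)
    define x' where "x' r = Linf ((coord x)(l := r))" for r
    define t where "t = (1 + coord x l) / 2"
    have t: "0 \<le> t" "t \<le> 1"
      using insert.prems(1) [of l] by (auto simp: t_def)
    have "norm (T (x' r)) \<le> 1" if "r \<in> {-1, 1}" for r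
      using that insert.prems by (intro insert.IH) (auto simp: x'_def Linf_inverse)
    then have "norm (t *\<^sub>R T (x' 1) + (1 - t) *\<^sub>R T (x' (-1))) \<le> t * 1 + (1 - t) * 1"
      using t by (intro norm_triangle_le add_mono) (simp_all add: mult_left_le)
    moreover have "x = t *\<^sub>R x' 1 + (1 - t) *\<^sub>R x' (-1)"
      by (rule linf_eqI) (simp add: x'_def Linf_inverse t_def field_simps)
    then have "T x = t *\<^sub>R T (x' 1) + (1 - t) *\<^sub>R T (x' (-1))"
      by (metis blinfun.add_right blinfun.scaleR_right)
    ultimately show ?case by simp
  qed
  show ?thesis
  proof (rule norm_blinfun_bound)
    fix x
    show "norm (T x) \<le> 1 * norm x"
    proof (cases "x = 0")
      case False
      have "\<bar>coord (x /\<^sub>R norm x) j\<bar> \<le> 1" for j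
        using abs_coord_le_norm [of "x /\<^sub>R norm x" j] False by simp
      then have "norm (T (x /\<^sub>R norm x)) \<le> 1"
        by (intro cube [of UNIV]) auto
      then show ?thesis
        using False by (simp add: blinfun.bilinear_simps field_simps)
    qed simp
  qed simp
qed

end

subsection \<open>The equivalence\<close>

text \<open>If u + t (u - v i) stays in the ball, then \<phi> takes there the value 1 + t (1 -
  \<phi> (v i)) \<le> 1, which forces \<phi> (v i) \<ge> 1.\<close>

lemma (in kuhn_basis) functional_attaining_near_centroid:
  fixes \<phi> :: "'n linf \<Rightarrow>\<^sub>L real"
  assumes "norm \<phi> \<le> 1" "norm u \<le> 1" "\<phi> u = 1"
    and A: "A \<subseteq> {1..n}" "i \<in> A"
    and near: "norm (u - (1 / real (card A)) *\<^sub>R (\<Sum>i\<in>A. v i)) \<le> 1 / real n"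
  shows "\<phi> (v i) = 1"
proof -
  have "finite A" using A(1) finite_subset by blast
  define m where "m = real (card A)"
  have m: "1 \<le> m" "m \<le> n"
    using A \<open>finite A\<close> card_mono [OF _ A(1)] card_gt_0_iff [of A] by (auto simp: m_def Suc_le_eq)
  \<comment> \<open>With e the sign of \<open>v i\<close> in a coordinate, e u is at least -1 + 1/n
    = -1 + 2 t. The prolongation lowers this by at most t (2 - 2 t), which leaves -1 + 2
    t^2.\<close>
  define t where "t = 1 / (2 * real n)"
  have t: "0 < t" "t \<le> 1/2"
    using n_pos by (auto simp: t_def field_simps)
  have "norm (u + t *\<^sub>R (u - v i)) \<le> 1"
    unfolding norm_linf_le_iff
  proof
    fix j
    define e where "e = coord (v i) j"
    have e: "e = 1 \<or> e = -1" by (simp add: e_def coord_v)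
    \<comment> \<open>The term k = i contributes e e = 1 and every other one at least -1. The mean
      is thus at least 2/m - 1, and the distance 1/n \<le> 1/m from u leaves 1/n - 1.\<close>
    have "(\<Sum>k\<in>A - {i}. e * coord (v k) j) \<ge> (\<Sum>k\<in>A - {i}. - 1)"
      using e by (intro sum_mono) (auto simp: coord_v)
    then have "2 - m \<le> e * (\<Sum>k\<in>A. coord (v k) j)"
      using \<open>finite A\<close> A(2) e m
      by (subst sum.remove [of A i]) (auto simp: m_def sum_distrib_left e_def [symmetric] algebra_simps)
    then have "(2 - m) / m \<le> e * (\<Sum>k\<in>A. coord (v k) j) / m"
      using m by (intro divide_right_mono) auto
    moreover have "\<bar>coord u j - (\<Sum>k\<in>A. coord (v k) j) / m\<bar> \<le> 1 / real n"
      using order_trans [OF abs_coord_le_norm near, of j] \<open>finite A\<close> by (simp add: coord_sum m_def)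
    moreover have "1 / real n \<le> 1 / m" "(2 - m) / m = 2 / m - 1"
      using m by (auto simp: field_simps)
    ultimately have lower: "1 / real n - 1 \<le> e * coord u j"
      using e by (auto simp: abs_le_iff)
    have upper: "e * coord u j \<le> 1"
      using e order_trans [OF abs_coord_le_norm \<open>norm u \<le> 1\<close>, of j] by auto
    have nt: "1 / real n = 2 * t" by (simp add: t_def)
    have "t * (e * coord u j - 1) \<le> 0"
      using t upper by (intro mult_nonneg_nonpos) auto
    moreover have "t * (2 * t - 2) \<le> t * (e * coord u j - 1)"
      using t lower nt by (intro mult_left_mono) auto
    then have "2 * (t * t) - 2 * t \<le> t * (e * coord u j - 1)"
      by (simp add: algebra_simps)
    ultimately have "\<bar>e * coord u j + t * (e * coord u j - 1)\<bar> \<le> 1"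
      using upper lower nt zero_le_square [of t] unfolding abs_le_iff by linarith
    then show "\<bar>coord (u + t *\<^sub>R (u - v i)) j\<bar> \<le> 1"
      using e unfolding e_def [symmetric] by (auto simp: e_def [symmetric] abs_le_iff algebra_simps)
  qed
  then have "norm (\<phi> (u + t *\<^sub>R (u - v i))) \<le> 1 * 1"
    using \<open>norm \<phi> \<le> 1\<close> by (intro order_trans [OF norm_blinfun] mult_mono) auto
  then have "t * (1 - \<phi> (v i)) \<le> 0"
    by (simp add: blinfun.bilinear_simps \<open>\<phi> u = 1\<close>)
  then have "1 \<le> \<phi> (v i)"
    using t by (simp add: mult_le_0_iff)
  moreover have "norm (\<phi> (v i)) \<le> 1 * 1"
    using \<open>norm \<phi> \<le> 1\<close> by (intro order_trans [OF norm_blinfun] mult_mono) (auto simp: norm_v)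
  ultimately show ?thesis by simp
qed

text \<open>For g the coordinates of a point this gives the simplex adapted to it; a constant g
  gives just some basis.\<close>

lemma sorted_kuhn_basis:
  fixes g :: "'n::finite \<Rightarrow> real"
  obtains \<sigma> \<rho> where "kuhn_basis CARD('n) \<sigma> \<rho>" "mono_on {1..CARD('n)} (g \<circ> \<sigma>)"
proof -
  obtain xs where xs: "set xs = (UNIV :: 'n set)" "distinct xs"
    using finite_distinct_list [OF finite] by blast
  define ys where "ys = sort_key g xs"
  have ys: "set ys = UNIV" "distinct ys" "sorted (map g ys)"
    using xs by (auto simp: ys_def)
  have len: "length ys = CARD('n)"
    using distinct_card [OF ys(2)] ys(1) by simp
  define \<sigma> where "\<sigma> i = ys ! (i - 1)" for i
  have "inj_on \<sigma> {1..CARD('n)}"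
    using ys(2) by (auto simp: inj_on_def \<sigma>_def nth_eq_iff_index_eq len)
  have "\<exists>i\<in>{1..CARD('n)}. \<sigma> i = j" for j
  proof -
    obtain k where "k < CARD('n)" "ys ! k = j"
      using ys(1) len by (metis UNIV_I in_set_conv_nth)
    then show ?thesis
      by (intro bexI [of _ "Suc k"]) (auto simp: \<sigma>_def)
  qed
  then obtain \<rho> where \<rho>: "\<And>j. \<rho> j \<in> {1..CARD('n)}" "\<And>j. \<sigma> (\<rho> j) = j"
    by metis
  show thesis
  proof
    show "kuhn_basis CARD('n) \<sigma> \<rho>"
      using \<rho> inj_onD [OF \<open>inj_on \<sigma> _\<close>] by unfold_locales blast+
    show "mono_on {1..CARD('n)} (g \<circ> \<sigma>)"
      using sorted_nth_mono [OF ys(3)] by (auto intro!: monotone_onI simp: \<sigma>_def len)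
  qed
qed

lemma norm_blinfun_le_one:
  assumes "norm T \<le> 1" "norm x \<le> 1"
  shows "norm (blinfun_apply T x) \<le> 1"
  using order_trans [OF norm_blinfun mult_mono [OF assms]] by simp

section \<open>From the BPBp to the AHSp\<close>

lemma AHSp_if_BPBp:
  assumes B: "BPBp_with TYPE('n::finite linf) TYPE('y::banach) \<eta>" and n: "n = CARD('n)"
  shows "AHSp_linf_with n TYPE('y) (\<lambda>\<epsilon>. \<eta> (\<epsilon> / (real n * (real n + 1))))"
  unfolding AHSp_linf_with_def
proof (intro allI impI, elim conjE)
  fix \<epsilon> :: real
  assume \<epsilon>: "0 < \<epsilon>" "\<epsilon> < 1"
  obtain \<sigma> :: "nat \<Rightarrow> 'n" and \<rho> where "kuhn_basis n \<sigma> \<rho>"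
    using sorted_kuhn_basis [of "\<lambda>_::'n. 0"] n by blast
  then interpret kuhn_basis n \<sigma> \<rho> .
  \<comment> \<open>Two consequences of this choice are used: \<delta> \<le> 1/n, to be near enough
    to the centroid, and 2 \<delta> \<le> \<epsilon>, as both the normalisation of T and its
    approximation cost less than \<delta>.\<close>
  define \<delta> where "\<delta> = \<epsilon> / (real n * (real n + 1))"
  have n1: "1 \<le> real n" using n_pos by simp
  then have "1 * 2 \<le> real n * (real n + 1)"
    by (intro mult_mono) auto
  then have "\<epsilon> * 2 \<le> \<epsilon> * (real n * (real n + 1))"
    using \<epsilon> by (intro mult_left_mono) auto
  then have \<delta>: "0 < \<delta>" "2 * \<delta> \<le> \<epsilon>"
    using \<epsilon> n1 by (auto simp: \<delta>_def pos_le_divide_eq pos_divide_le_eq mult.commute)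
  have "\<epsilon> \<le> real n + 1" using \<epsilon> n1 by simp
  then have "\<delta> \<le> (real n + 1) / (real n * (real n + 1))"
    unfolding \<delta>_def by (rule divide_right_mono) simp
  then have \<delta>n: "\<delta> \<le> 1 / real n"
    by simp
  have "\<delta> < 1" using \<delta> \<epsilon> by simp
  note BPB_\<delta> = mp [OF spec [OF B [unfolded BPBp_with_def], of \<delta>] conjI [OF \<delta>(1) this]]
  then have \<eta>: "0 < \<eta> \<delta>" "\<eta> \<delta> < \<delta>"
    by simp_all
  have BPB: "\<And>(T :: 'n linf \<Rightarrow>\<^sub>L 'y) x0. norm T = 1 \<Longrightarrow> norm x0 = 1 \<Longrightarrow>
      norm (blinfun_apply T x0) > 1 - \<eta> \<delta> \<Longrightarrow>
      \<exists>(S :: 'n linf \<Rightarrow>\<^sub>L 'y) u0. norm S = 1 \<and> norm u0 = 1 \<and> norm (blinfun_apply S u0) = 1 \<and>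
        norm (u0 - x0) < \<delta> \<and> norm (S - T) < \<delta>"
    using BPB_\<delta> by blast
  have "\<exists>z \<in> M n. (\<forall>i\<in>{1..n}. norm (z i - y i) < \<epsilon>) \<and> norm (\<Sum>i\<in>A. z i) = real (card A)"
    if y: "y \<in> M n" and A: "A \<noteq> {}" "A \<subseteq> {1..n}" and "norm f = 1"
      and f: "\<And>i. i \<in> A \<Longrightarrow> blinfun_apply f (y i) > 1 - \<eta> \<delta>"
    for y :: "nat \<Rightarrow> 'y" and A and f :: "'y \<Rightarrow>\<^sub>L real"
  proof -
    have "finite A" using A(2) finite_subset by blast
    define m where "m = real (card A)"
    have m: "0 < m" using A \<open>finite A\<close> by (simp add: m_def card_gt_0_iff)
    obtain T :: "'n linf \<Rightarrow>\<^sub>L 'y" where T: "\<And>i. i \<in> {1..n} \<Longrightarrow> T (v i) = y i"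
      using obtain_blinfun by blast
    have T1: "norm T \<le> 1" using norm_le_one_if_in_M [OF y T] .
    define x0 where "x0 = (1 / m) *\<^sub>R (\<Sum>i\<in>A. v i)"
    have "norm (\<Sum>i\<in>A. v i) \<le> m"
      using norm_sum [of v A] by (simp add: norm_v m_def)
    then have x0_le: "norm x0 \<le> 1"
      using m by (simp add: x0_def field_simps)
    have "(\<Sum>i\<in>A. 1 - \<eta> \<delta>) < (\<Sum>i\<in>A. f (y i))"
      using A f \<open>finite A\<close> by (intro sum_strict_mono) auto
    moreover have "f (T x0) = (\<Sum>i\<in>A. f (y i)) / m"
      using A(2) T by (simp add: x0_def blinfun.bilinear_simps subset_iff)
    ultimately have "1 - \<eta> \<delta> < f (T x0)"
      using m by (simp add: m_def pos_less_divide_eq mult.commute)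
    also have "\<dots> \<le> norm (f (T x0))" by simp
    also have "\<dots> \<le> norm (T x0)"
      using norm_blinfun [of f "T x0"] \<open>norm f = 1\<close> by simp
    finally have Tx0: "1 - \<eta> \<delta> < norm (T x0)" .
    also have "\<dots> \<le> norm T"
      using norm_blinfun [of T x0] mult_left_mono [OF x0_le, of "norm T"] by simp
    finally have T_gt: "1 - \<eta> \<delta> < norm T" .
    have T0: "0 < norm T"
      using T_gt \<eta> \<delta> \<epsilon> by linarith
    have "norm x0 = 1"
    proof -
      \<comment> \<open>All \<open>v i\<close> share the last coordinate 1, so averaging them does
        not lower the norm.\<close>
      have "coord x0 (\<sigma> n) = 1"
      proof -
        have "(\<Sum>i\<in>A. coord (v i) (\<sigma> n)) = (\<Sum>i\<in>A. 1)"
          using A(2) n_pos by (intro sum.cong) (auto simp: coord_v rho_sigma)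
        then show ?thesis
          using A(1) \<open>finite A\<close> by (simp add: x0_def coord_sum m_def)
      qed
      then show ?thesis
        using x0_le abs_coord_le_norm [of x0 "\<sigma> n"] by simp
    qed
    \<comment> \<open>Division by norm T \<le> 1 does not decrease the value at x0, and it moves T
      by 1 - norm T < \<eta> \<delta>.\<close>
    define T' where "T' = T /\<^sub>R norm T"
    have "norm T' = 1" using T0 by (simp add: T'_def)
    have "norm (T x0) * norm T \<le> norm (T x0) * 1"
      using T1 by (intro mult_left_mono) auto
    then have "norm (T x0) \<le> norm (T' x0)"
      using T0 by (simp add: T'_def scaleR_blinfun.rep_eq field_simps)
    then obtain S u where S: "norm S = 1" "norm u = 1" "norm (blinfun_apply S u) = 1"
        "norm (u - x0) < \<delta>" "norm (S - T') < \<delta>"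
      using BPB [OF \<open>norm T' = 1\<close> \<open>norm x0 = 1\<close>] Tx0 by auto
    have "T' - T = (1 / norm T - 1) *\<^sub>R T"
      by (simp add: T'_def algebra_simps divide_inverse)
    then have "norm (T' - T) = \<bar>1 / norm T - 1\<bar> * norm T"
      by simp
    also have "\<dots> = 1 - norm T"
      using T0 T1 by (simp add: left_diff_distrib abs_of_nonneg)
    finally have "norm (T' - T) = 1 - norm T" .
    then have "norm (S - T) < \<delta> + \<delta>"
      using S(5) T_gt \<eta> norm_triangle_ineq [of "S - T'" "T' - T"] by simp
    then have ST: "norm (S - T) < \<epsilon>"
      using \<delta> by simp
    \<comment> \<open>A functional h norming S u turns S into a real functional that attains its
      norm at u, hence equals 1 at all \<open>v i\<close> with i in A.\<close>
    have "S u \<noteq> 0" using S(3) by auto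
    then obtain h :: "'y \<Rightarrow>\<^sub>L real" where h: "norm h = 1" "h (S u) = 1"
      using norming_functional [of "S u"] S(3) by metis
    have hS: "norm (h o\<^sub>L S) \<le> 1"
      using norm_blinfun_compose [of h S] h S by simp
    have hz: "h (S (v i)) = 1" if "i \<in> A" for i
      using functional_attaining_near_centroid [OF hS _ _ A(2) that, of u] S h \<delta>n
      by (simp add: x0_def m_def)
    let ?z = "\<lambda>i. S (v i)"
    have "?z \<in> M n" using S by (intro blinfun_in_M) simp
    moreover have "norm (?z i - y i) < \<epsilon>" if "i \<in> {1..n}" for i
      using norm_blinfun [of "S - T" "v i"] ST T [OF that]
      by (simp add: norm_v blinfun.diff_left)
    moreover have "norm (\<Sum>i\<in>A. ?z i) = real (card A)"
    proof (rule antisym)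
      have "norm (\<Sum>i\<in>A. ?z i) \<le> (\<Sum>i\<in>A. 1)"
        using S by (intro sum_norm_le norm_blinfun_le_one) (simp_all add: norm_v)
      then show "norm (\<Sum>i\<in>A. ?z i) \<le> real (card A)" by simp
      have "real (card A) = h (\<Sum>i\<in>A. ?z i)"
        using hz by (simp add: blinfun.bilinear_simps)
      also have "\<dots> \<le> norm (\<Sum>i\<in>A. ?z i)"
        using norm_blinfun [of h "\<Sum>i\<in>A. ?z i"] h by simp
      finally show "real (card A) \<le> norm (\<Sum>i\<in>A. ?z i)" .
    qed
    ultimately show ?thesis
      by (intro bexI [of _ ?z] conjI ballI)
  qed
  note approx = this
  show "0 < \<eta> (\<epsilon> / (real n * (real n + 1))) \<and> \<eta> (\<epsilon> / (real n * (real n + 1))) < \<epsilon> \<and>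
    (\<forall>(y :: nat \<Rightarrow> 'y) \<in> M n. \<forall>A (f :: 'y \<Rightarrow>\<^sub>L real).
       A \<noteq> {} \<and> A \<subseteq> {1..n} \<and> norm f = 1 \<and>
       (\<forall>i\<in>A. blinfun_apply f (y i) > 1 - \<eta> (\<epsilon> / (real n * (real n + 1)))) \<longrightarrow>
       (\<exists>z \<in> M n. (\<forall>i\<in>{1..n}. norm (z i - y i) < \<epsilon>) \<and> norm (\<Sum>i\<in>A. z i) = real (card A)))"
    unfolding \<delta>_def [symmetric]
  proof (intro conjI ballI allI impI)
    show "0 < \<eta> \<delta>" "\<eta> \<delta> < \<epsilon>"
      using \<eta> \<delta> by simp_all
  qed (elim conjE, rule approx, auto)
qed

section \<open>From the AHSp to the BPBp\<close>

lemma AHSp_approximation_max_coord: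
  fixes T :: "'n::finite linf \<Rightarrow>\<^sub>L 'y::banach"
  assumes AHSp: "AHSp_linf_with n TYPE('y) \<gamma>" and n: "n = CARD('n)"
    and \<delta>: "0 < \<delta>" "\<delta> < 1"
    and T: "norm T = 1" and x0: "norm x0 = 1" "coord x0 j = 1"
    and Tx0: "norm (T x0) > 1 - (\<gamma> \<delta>)\<^sup>2"
  shows "\<exists>(S :: 'n linf \<Rightarrow>\<^sub>L 'y) u. norm S = 1 \<and> norm u = 1 \<and> norm (blinfun_apply S u) = 1 \<and>
    norm (u - x0) < 2 * \<delta> \<and> norm (S - T) < real n * \<delta>"
proof -
  obtain \<sigma> \<rho> where basis: "kuhn_basis n \<sigma> \<rho>" and mono: "mono_on {1..n} (coord x0 \<circ> \<sigma>)"
    using sorted_kuhn_basis [of "coord x0"] n by blast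
  interpret kuhn_basis n \<sigma> \<rho> by (rule basis)
  note AHSp_\<delta> = mp [OF spec [OF AHSp [unfolded AHSp_linf_with_def], of \<delta>] conjI [OF \<delta>]]
  then have \<gamma>: "0 < \<gamma> \<delta>" "\<gamma> \<delta> < \<delta>"
    by simp_all
  have hyperplane: "\<exists>z \<in> M n. (\<forall>i\<in>{1..n}. norm (z i - y i) < \<delta>) \<and>
        norm (\<Sum>i\<in>A. z i) = real (card A)"
    if "y \<in> M n" "A \<noteq> {}" "A \<subseteq> {1..n}" "norm f = 1"
      "\<forall>i\<in>A. blinfun_apply f (y i) > 1 - \<gamma> \<delta>"
    for y :: "nat \<Rightarrow> 'y" and A and f :: "'y \<Rightarrow>\<^sub>L real"
    using AHSp_\<delta> that by blast
  have le1: "\<bar>coord x0 i\<bar> \<le> 1" for i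
    using abs_coord_le_norm [of x0 i] x0 by simp
  \<comment> \<open>Sorting moves the maximal coordinate 1 to the end, so the weights
    \<open>c i x0\<close> sum to 1. They are nonnegative by monotonicity, and for i = 1 because the
    cyclic convention sets X 0 = -1.\<close>
  have "coord x0 (\<sigma> (\<rho> j)) \<le> coord x0 (\<sigma> n)"
    using mono_onD [OF mono, of "\<rho> j" n] rho_mem [of j] by simp
  then have Xn: "X x0 n = 1"
    using x0(2) le1 [of "\<sigma> n"] n_pos by (simp add: sigma_rho X_def)
  have c_nonneg: "0 \<le> c i x0" if "i \<in> {1..n}" for i
  proof (cases "i = 1")
    case True
    then show ?thesis
      using Xn X_zero [of x0] abs_X_le [of x0 1] x0 by (simp add: c_def)
  next
    case False
    then have "i - 1 \<in> {1..n}" using that by auto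
    then show ?thesis
      using False that mono_onD [OF mono, of "i - 1" i] by (simp add: c_def X_def)
  qed
  have Tv: "norm (T (v i)) \<le> 1" for i
    using T by (intro norm_blinfun_le_one) (simp_all add: norm_v)
  have "(\<gamma> \<delta>)\<^sup>2 < 1"
    using \<gamma> \<delta> by (simp add: power_less_one_iff)
  then have "T x0 \<noteq> 0" using Tx0 by auto
  then obtain f :: "'y \<Rightarrow>\<^sub>L real" where f: "norm f = 1" "f (T x0) = norm (T x0)"
    using norming_functional by blast
  have f_le: "f (T (v i)) \<le> 1" for i
    using norm_blinfun_le_one [of f "T (v i)"] f Tv by (simp add: abs_le_iff)
  define A where "A = {i\<in>{1..n}. f (T (v i)) > 1 - \<gamma> \<delta>}"
  define B where "B = {1..n} - A"
  define s where "s = (\<Sum>i\<in>A. c i x0)"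
  have AB: "A \<subseteq> {1..n}" "finite A" "finite B" "{1..n} = A \<union> B" "A \<inter> B = {}"
    by (auto simp: A_def B_def)
  have split: "(\<Sum>i=1..n. g i) = (\<Sum>i\<in>A. g i) + (\<Sum>i\<in>B. g i)" for g :: "nat \<Rightarrow> 'b::comm_monoid_add"
    unfolding AB(4) using AB by (intro sum.union_disjoint) auto
  have sB: "(\<Sum>i\<in>B. c i x0) = 1 - s"
    using sum_c_all [of x0] Xn unfolding split s_def by simp
  \<comment> \<open>With s the mass of A, f (T x0) is at most 1 - \<gamma> (1 - s) and exceeds 1 -
    \<gamma>^2, where \<gamma> stands for \<open>\<gamma> \<delta>\<close>. The square therefore
    leaves 1 - s < \<gamma>.\<close>
  have "f (T x0) = (\<Sum>i=1..n. c i x0 * f (T (v i)))"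
    by (subst blinfun_expansion) (simp add: blinfun.bilinear_simps)
  also have "\<dots> \<le> (\<Sum>i\<in>A. c i x0 * 1) + (\<Sum>i\<in>B. c i x0 * (1 - \<gamma> \<delta>))"
    unfolding split using c_nonneg f_le
    by (intro add_mono sum_mono mult_left_mono) (auto simp: A_def B_def)
  also have "\<dots> = s + (1 - s) * (1 - \<gamma> \<delta>)"
    by (simp add: s_def [symmetric] sum_distrib_right [symmetric] sB)
  finally have "\<gamma> \<delta> * (1 - s) < \<gamma> \<delta> * \<gamma> \<delta>"
    using f(2) Tx0 by (simp add: power2_eq_square algebra_simps)
  then have s: "1 - s < \<gamma> \<delta>"
    using \<gamma> by simp
  have "0 \<le> (\<Sum>i\<in>B. c i x0)"
    using c_nonneg AB by (intro sum_nonneg) auto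
  then have s1: "s \<le> 1" using sB by simp
  have s0: "0 < s" using s \<gamma> \<delta> by simp
  then have "A \<noteq> {}" by (auto simp: s_def)
  have "(\<lambda>i. T (v i)) \<in> M n"
    using T by (intro blinfun_in_M) simp
  then obtain z where z: "z \<in> M n" "\<And>i. i \<in> {1..n} \<Longrightarrow> norm (z i - T (v i)) < \<delta>"
      "norm (\<Sum>i\<in>A. z i) = real (card A)"
    using hyperplane [OF _ \<open>A \<noteq> {}\<close> AB(1) f(1)] unfolding A_def by blast
  obtain S :: "'n linf \<Rightarrow>\<^sub>L 'y" where S: "\<And>i. i \<in> {1..n} \<Longrightarrow> S (v i) = z i"
    using obtain_blinfun by blast
  have S1: "norm S \<le> 1" using norm_le_one_if_in_M [OF z(1) S] .
  have z1: "norm (z i) \<le> 1" if "i \<in> {1..n}" for i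
    using norm_blinfun_le_one [OF S1, of "v i"] S [OF that] by (simp add: norm_v)
  have "(\<Sum>i\<in>A. z i) \<noteq> 0"
    using z(3) \<open>A \<noteq> {}\<close> AB by auto
  then obtain h :: "'y \<Rightarrow>\<^sub>L real" where h: "norm h = 1" "h (\<Sum>i\<in>A. z i) = real (card A)"
    using norming_functional z(3) by metis
  have h_le: "h (z i) \<le> 1" if "i \<in> A" for i
    using norm_blinfun_le_one [of h "z i"] h z1 AB(1) that by (auto simp: abs_le_iff)
  \<comment> \<open>The values h (z i) are at most 1 and sum to the cardinality of A, so each equals
    1.\<close>
  have "(\<Sum>i\<in>A. 1 - h (z i)) = 0"
    using h(2) by (simp add: sum_subtractf blinfun.bilinear_simps)
  then have hz: "h (z i) = 1" if "i \<in> A" for i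
    using that h_le sum_nonneg_eq_0_iff [of A "\<lambda>i. 1 - h (z i)"] AB(2) by simp
  \<comment> \<open>u is the part of x0 over A, renormalised to a convex combination; w is the rest,
    of norm at most 1 - s. Then u - x0 = (1 - s) u - w has norm at most 2 (1 - s).\<close>
  define w where "w = (\<Sum>i\<in>B. c i x0 *\<^sub>R v i)"
  define u where "u = (1 / s) *\<^sub>R (\<Sum>i\<in>A. c i x0 *\<^sub>R v i)"
  have norm_c_sum: "norm (\<Sum>i\<in>I. c i x0 *\<^sub>R v i) \<le> (\<Sum>i\<in>I. c i x0)" if "I \<subseteq> {1..n}" for I
    using that c_nonneg by (intro sum_norm_le) (auto simp: norm_v subset_iff)
  have u1: "norm u \<le> 1"
    using norm_c_sum [OF AB(1)] s0 by (simp add: u_def s_def [symmetric] field_simps)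
  have "h (S u) = (1 / s) * (\<Sum>i\<in>A. c i x0 * h (z i))"
    using AB(1) S by (simp add: u_def blinfun.bilinear_simps subset_iff)
  also have "(\<Sum>i\<in>A. c i x0 * h (z i)) = s"
    unfolding s_def by (intro sum.cong) (simp_all add: hz)
  finally have "h (S u) = 1" using s0 by simp
  then have "1 \<le> norm (S u)"
    using norm_blinfun [of h "S u"] h(1) by simp
  moreover have "norm (S u) \<le> norm S" "norm (S u) \<le> norm u"
    using norm_blinfun [of S u] mult_left_mono [OF u1, of "norm S"] mult_right_mono [OF S1, of "norm u"]
    by simp_all
  ultimately have one: "norm S = 1" "norm u = 1" "norm (S u) = 1"
    using S1 u1 by auto
  have "x0 = s *\<^sub>R u + w"
    using expansion [of x0] s0 unfolding split u_def w_def by simp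
  then have "u - x0 = (1 - s) *\<^sub>R u - w"
    by (simp add: algebra_simps)
  also have "norm \<dots> \<le> (1 - s) + (1 - s)"
    using s1 norm_c_sum [of B] sB AB one
    by (intro order_trans [OF norm_triangle_ineq4 add_mono]) (auto simp: w_def)
  finally have "norm (u - x0) < 2 * \<delta>"
    using s \<gamma> by simp
  moreover have "norm (S - T) < real n * \<delta>"
  proof -
    have "norm (S - T) \<le> (\<Sum>i=1..n. norm ((S - T) (v i)))"
      by (rule norm_blinfun_le_sum)
    also have "\<dots> < (\<Sum>i=1..n. \<delta>)"
      using z(2) S n_pos by (intro sum_strict_mono) (auto simp: blinfun.diff_left)
    finally show ?thesis by simp
  qed
  ultimately show ?thesis using one by blast
qed

lemma BPBp_if_AHSp:
  assumes AHSp: "AHSp_linf_with n TYPE('y::banach) \<gamma>" and n: "n = CARD('n::finite)"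
  shows "BPBp_with TYPE('n linf) TYPE('y) (\<lambda>\<epsilon>. (\<gamma> (\<epsilon> / (real n + 1)))\<^sup>2)"
  unfolding BPBp_with_def
proof (intro allI impI, elim conjE)
  fix \<epsilon> :: real
  assume \<epsilon>: "0 < \<epsilon>" "\<epsilon> < 1"
  \<comment> \<open>The divisor n + 1 makes n \<delta> < \<epsilon> strict for the operators, and n
    + 1 \<ge> 2 gives 2 \<delta> \<le> \<epsilon> for the points.\<close>
  define \<delta> where "\<delta> = \<epsilon> / (real n + 1)"
  have n1: "1 \<le> real n" using n by (simp add: Suc_le_eq)
  have "\<epsilon> * 2 \<le> \<epsilon> * (real n + 1)"
    using n1 \<epsilon> by (intro mult_left_mono) auto
  then have \<delta>: "0 < \<delta>" "\<delta> < 1" "2 * \<delta> \<le> \<epsilon>" "real n * \<delta> < \<epsilon>"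
    using \<epsilon> n1 by (auto simp: \<delta>_def field_simps)
  have \<gamma>: "0 < \<gamma> \<delta>" "\<gamma> \<delta> < \<delta>"
    using AHSp \<delta> unfolding AHSp_linf_with_def by auto
  have "\<gamma> \<delta> * \<gamma> \<delta> \<le> \<gamma> \<delta> * 1"
    using \<gamma> \<delta> by (intro mult_left_mono) auto
  then have \<gamma>2: "(\<gamma> \<delta>)\<^sup>2 < \<epsilon>"
    using \<gamma> \<delta> unfolding power2_eq_square by linarith
  have "\<exists>(S :: 'n linf \<Rightarrow>\<^sub>L 'y) u. norm S = 1 \<and> norm u = 1 \<and> norm (blinfun_apply S u) = 1 \<and>
      norm (u - x0) < \<epsilon> \<and> norm (S - T) < \<epsilon>"
    if T: "norm T = 1" and x0: "norm x0 = 1" and Tx0: "norm (T x0) > 1 - (\<gamma> \<delta>)\<^sup>2"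
    for T :: "'n linf \<Rightarrow>\<^sub>L 'y" and x0
  proof -
    \<comment> \<open>The maximum is attained at some coordinate. If its value is -1, the
      approximation is made at -x0 and the point found is negated.\<close>
    have "\<exists>j. \<bar>coord x0 j\<bar> = 1"
      using Max_in [of "range (\<lambda>j. \<bar>coord x0 j\<bar>)"] x0 unfolding norm_linf_def by fastforce
    then obtain j where "coord x0 j = 1 \<or> coord (- x0) j = 1"
      by (auto simp: abs_if split: if_splits)
    then show ?thesis
    proof
      assume "coord x0 j = 1"
      then show ?thesis
        using AHSp_approximation_max_coord [OF AHSp n \<delta>(1,2) T x0 _ Tx0] \<delta>
        by (meson less_le_trans less_trans)
    next
      assume "coord (- x0) j = 1"
      moreover have "norm (- x0) = 1" "norm (T (- x0)) > 1 - (\<gamma> \<delta>)\<^sup>2"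
        using x0 Tx0 by (simp_all add: blinfun.minus_right)
      ultimately obtain S u where "norm S = 1" "norm u = 1" "norm (blinfun_apply S u) = 1"
          "norm (u - - x0) < 2 * \<delta>" "norm (S - T) < real n * \<delta>"
        using AHSp_approximation_max_coord [OF AHSp n \<delta>(1,2) T] by blast
      moreover have "norm (- u - x0) = norm (u - - x0)"
        using norm_minus_cancel [of "u - - x0"] by (simp add: algebra_simps)
      ultimately show ?thesis
        using \<delta> by (intro exI [of _ S] exI [of _ "- u"]) (auto simp: blinfun.minus_right)
    qed
  qed
  note approx = this
  show "0 < (\<gamma> (\<epsilon> / (real n + 1)))\<^sup>2 \<and> (\<gamma> (\<epsilon> / (real n + 1)))\<^sup>2 < \<epsilon> \<and>
    (\<forall>(T :: 'n linf \<Rightarrow>\<^sub>L 'y) x0.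
       norm T = 1 \<and> norm x0 = 1 \<and> norm (blinfun_apply T x0) > 1 - (\<gamma> (\<epsilon> / (real n + 1)))\<^sup>2 \<longrightarrow>
       (\<exists>(S :: 'n linf \<Rightarrow>\<^sub>L 'y) u0.
          norm S = 1 \<and> norm u0 = 1 \<and> norm (blinfun_apply S u0) = 1 \<and>
          norm (u0 - x0) < \<epsilon> \<and> norm (S - T) < \<epsilon>))"
    unfolding \<delta>_def [symmetric]
  proof (intro conjI allI impI)
    show "0 < (\<gamma> \<delta>)\<^sup>2" "(\<gamma> \<delta>)\<^sup>2 < \<epsilon>"
      using \<gamma> \<gamma>2 by simp_all
  qed (elim conjE, rule approx)
qed

theorem theorem3p3:
  fixes n :: nat
  assumes "n = CARD('n::finite)"
  shows "(BPBp TYPE('n linf) TYPE('y::banach) \<longleftrightarrow> AHSp_linf n TYPE('y)) \<and>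
    (\<forall>\<eta>. BPBp_with TYPE('n linf) TYPE('y) \<eta> \<longrightarrow>
       AHSp_linf_with n TYPE('y) (\<lambda>\<epsilon>. \<eta> (\<epsilon> / (real n * (real n + 1))))) \<and>
    (\<forall>\<gamma>. AHSp_linf_with n TYPE('y) \<gamma> \<longrightarrow>
       BPBp_with TYPE('n linf) TYPE('y) (\<lambda>\<epsilon>. (\<gamma> (\<epsilon> / (real n + 1)))\<^sup>2))"
proof -
  note BA = AHSp_if_BPBp [where ?'n = 'n and ?'y = 'y, OF _ assms]
    and AB = BPBp_if_AHSp [where ?'n = 'n and ?'y = 'y, OF _ assms]
  show ?thesis
  proof (intro conjI iffI allI impI)
    assume "BPBp TYPE('n linf) TYPE('y)"
    then obtain \<eta> where "BPBp_with TYPE('n linf) TYPE('y) \<eta>"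
      unfolding BPBp_def by (rule exE)
    then show "AHSp_linf n TYPE('y)"
      unfolding AHSp_linf_def by - (intro exI, erule BA)
  next
    assume "AHSp_linf n TYPE('y)"
    then obtain \<gamma> where "AHSp_linf_with n TYPE('y) \<gamma>"
      unfolding AHSp_linf_def by (rule exE)
    then show "BPBp TYPE('n linf) TYPE('y)"
      unfolding BPBp_def by - (intro exI, erule AB)
  qed (fact BA, fact AB)
qed

end
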